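(* Every $g\in\mathbb{G}$ is a Markov map.
   Context: $\lambda$ is Lebesgue measure on $[0,1]$. A continuous map $h:[0,1]\to[0,1]$ is $\lambda$-preserving if $\lambda(A)=\lambda(h^{-1}(A))$ for every Borel set $A\subseteq[0,1]$. A dyadic number is a rational number whose denominator is an integer power of $2$. $\mathbb{G}$ ($\lambda$-preserving Thompson's monoid) is the set of continuous maps $g$ from $[0,1]$ onto $[0,1]$ such that: $g$ is $\lambda$-preserving; $g$ is piecewise affine; $g$ is differentiable except at finitely many points; the $x$-coordinate of each point of non-differentiability is dyadic; and on every interval where $g$ is differentiable, the derivative is of the form $\pm 2^k$ with $k\in\mathbb{Z}$. A breakpoint of a piecewise affine map is either an endpoint ($x=0$ or $x=1$) or a point at which the derivative is discontinuous. A point $x$ is preperiodic for $h$ if $h^n(x)=h^m(x)$ for some integers $n>m\ge0$. A piecewise affine interval map is a Markov map if all its breakpoints (their $x$-coordinates) are preperiodic. *)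

theory Defs
  imports "HOL-Analysis.Analysis"
begin

text \<open>
  Self-maps of the unit interval are represented by functions \<open>real \<Rightarrow> real\<close>; their values
  outside \<open>{0..1}\<close> are arbitrary and never matter.
\<close>

definition interval_map :: "(real \<Rightarrow> real) \<Rightarrow> bool" where
  "interval_map h \<longleftrightarrow> continuous_on {0..1} h \<and> h ` {0..1} \<subseteq> {0..1}"

definition lebesgue_preserving :: "(real \<Rightarrow> real) \<Rightarrow> bool" where
  "lebesgue_preserving h \<longleftrightarrow>
     (\<forall>A. A \<in> sets borel \<and> A \<subseteq> {0..1} \<longrightarrow>
        emeasure lborel A = emeasure lborel (h -` A \<inter> {0..1}))"

definition dyadic :: "real \<Rightarrow> bool" where
  "dyadic x \<longleftrightarrow> (\<exists>(p::int) (n::nat). x = of_int p / 2 ^ n)"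

text \<open>
  The set \<open>S\<close> collects the subdivision points; \<open>a\<close> and \<open>b\<close> below range over pairs of
  consecutive ones.
\<close>

definition piecewise_affine :: "(real \<Rightarrow> real) \<Rightarrow> bool" where
  "piecewise_affine h \<longleftrightarrow>
     (\<exists>S. finite S \<and> {0, 1} \<subseteq> S \<and> S \<subseteq> {0..1} \<and>
        (\<forall>a\<in>S. \<forall>b\<in>S. a < b \<and> {a<..<b} \<inter> S = {} \<longrightarrow>
           (\<exists>m c. \<forall>x\<in>{a..b}. h x = m * x + c)))"

text \<open>Differentiability relative to \<open>{0..1}\<close> is one-sided at the two endpoints.\<close>

definition nondiff_points :: "(real \<Rightarrow> real) \<Rightarrow> real set" where
  "nondiff_points h = {x \<in> {0..1}. \<not> h differentiable (at x within {0..1})}"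

definition thompson_monoid :: "(real \<Rightarrow> real) set" where
  "thompson_monoid =
     {g. continuous_on {0..1} g \<and> g ` {0..1} = {0..1} \<and>
         lebesgue_preserving g \<and>
         piecewise_affine g \<and>
         finite (nondiff_points g) \<and>
         (\<forall>x \<in> nondiff_points g. dyadic x) \<and>
         (\<forall>a b. 0 \<le> a \<and> a < b \<and> b \<le> 1 \<and> (\<forall>x\<in>{a<..<b}. g differentiable (at x)) \<longrightarrow>
            (\<exists>s\<in>{1, -1}. \<exists>k::int. \<forall>x\<in>{a<..<b}.
               (g has_real_derivative s * 2 powi k) (at x)))}"

text \<open>
  The derivative is a partial function, defined on the set of interior points of
  differentiability; it counts as discontinuous at an interior point where it does not exist.
\<close>

definition breakpoints :: "(real \<Rightarrow> real) \<Rightarrow> real set" where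
  "breakpoints h = {0, 1} \<union>
     {x \<in> {0<..<1}.
        \<not> (h differentiable (at x) \<and>
           continuous (at x within {y \<in> {0<..<1}. h differentiable (at y)}) (deriv h))}"

definition preperiodic :: "(real \<Rightarrow> real) \<Rightarrow> real \<Rightarrow> bool" where
  "preperiodic h x \<longleftrightarrow> (\<exists>m n::nat. m < n \<and> (h ^^ n) x = (h ^^ m) x)"

definition markov_map :: "(real \<Rightarrow> real) \<Rightarrow> bool" where
  "markov_map h \<longleftrightarrow>
     interval_map h \<and> piecewise_affine h \<and> (\<forall>x \<in> breakpoints h. preperiodic h x)"

end

theory Submission
  imports Defs
begin

text \<open>
  Choose \<open>N\<close> such that the grid of multiples of \<open>1 / 2 ^ N\<close> in \<open>{0..1}\<close> contains all points of
  non-differentiability. Measure preservation forbids slopes of absolute value less than \<open>1\<close>: an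
  interval on which \<open>g\<close> contracts lies in the preimage of its shorter image. So all slopes are
  integers and increments of \<open>g\<close> between grid points are multiples of \<open>1 / 2 ^ N\<close>. As \<open>g\<close> is onto
  and has no zero slope, the value \<open>0\<close> is taken at a grid point. Hence \<open>g\<close> maps the finite grid
  to itself, every grid point is preperiodic, and every breakpoint is a grid point.
\<close>

lemma dyadic_common_denominator:
  assumes "finite S" "\<forall>x\<in>S. dyadic x"
  obtains N :: nat where "\<And>x. x \<in> S \<Longrightarrow> x * 2 ^ N \<in> \<int>"
proof -
  have "\<exists>N::nat. \<forall>x\<in>S. x * 2 ^ N \<in> \<int>"
    using assms
  proof (induction S rule: finite_induct)
    case (insert y S)
    then obtain N where N: "\<forall>x\<in>S. x * 2 ^ N \<in> \<int>" by blast
    obtain p n where y: "y = of_int p / 2 ^ n"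
      using insert.prems unfolding dyadic_def by blast
    have "x * 2 ^ (N + n) \<in> \<int>" if "x \<in> S" for x
    proof -
      have "(x * 2 ^ N) * 2 ^ n \<in> \<int>" using N that by (simp add: Ints_mult Ints_power)
      then show ?thesis by (simp add: power_add mult.assoc)
    qed
    moreover have "y * 2 ^ (N + n) \<in> \<int>"
    proof -
      have "y * 2 ^ (N + n) = of_int (p * 2 ^ N)" by (simp add: y power_add)
      then show ?thesis by (metis Ints_of_int)
    qed
    ultimately show ?case by blast
  qed simp
  then show ?thesis using that by blast
qed

text \<open>Pigeonhole: the orbit of \<open>x\<close> stays in the finite set \<open>D\<close>, so
  two of its iterates coincide.\<close>

lemma preperiodic_finite_invariant:
  assumes "finite D" "x \<in> D" "h ` D \<subseteq> D"
  shows "preperiodic h x"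
proof -
  have "(h ^^ n) x \<in> D" for n
    by (induction n) (use assms(2,3) in auto)
  then have "finite (range (\<lambda>n. (h ^^ n) x))"
    by (intro finite_subset[OF _ assms(1)]) auto
  then have "\<not> inj (\<lambda>n. (h ^^ n) x)"
    using range_inj_infinite by blast
  then obtain m n where "m \<noteq> n" "(h ^^ m) x = (h ^^ n) x"
    by (auto simp: inj_def)
  then show ?thesis
    unfolding preperiodic_def by (metis nat_neq_iff)
qed

text \<open>The preimage of the image interval contains \<open>{a..b}\<close>, possibly along with
  pieces from other branches of \<open>g\<close>. Comparing measures gives \<open>b - a\<close> at
  most \<open>\<bar>m\<bar> * (b - a)\<close>.\<close>

lemma lebesgue_preserving_expanding:
  assumes g: "continuous_on {0..1} g" "g ` {0..1} \<subseteq> {0..1}" "lebesgue_preserving g"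
    and ab: "0 \<le> a" "a < b" "b \<le> 1"
    and affine: "\<And>x. x \<in> {a..b} \<Longrightarrow> g x = g a + m * (x - a)"
  shows "\<bar>m\<bar> \<ge> 1"
proof -
  \<comment> \<open>The image of \<open>{a..b}\<close>; \<open>min\<close> and \<open>max\<close>
    cover both signs of \<open>m\<close>.\<close>
  define A where "A = {min (g a) (g b)..max (g a) (g b)}"
  have gb: "g b = g a + m * (b - a)" using affine[of b] ab by simp
  have "A \<subseteq> {0..1}"
  proof -
    have "g a \<in> {0..1}" "g b \<in> {0..1}" using g(2) ab by (simp_all add: image_subset_iff)
    then show ?thesis unfolding A_def by auto
  qed
  moreover have "A \<in> sets borel" by (simp add: A_def)
  ultimately have meas: "emeasure lborel A = emeasure lborel (g -` A \<inter> {0..1})"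
    using g(3) unfolding lebesgue_preserving_def by blast
  \<comment> \<open>Monotonicity of the measure needs the larger set, this preimage, to be
    measurable.\<close>
  have "closed (g -` A \<inter> {0..1})"
    using continuous_closed_preimage[OF g(1), of A] by (simp add: A_def Int_commute)
  then have "g -` A \<inter> {0..1} \<in> sets lborel" by simp
  moreover have "{a..b} \<subseteq> g -` A \<inter> {0..1}"
  proof
    fix x assume x: "x \<in> {a..b}"
    have "g x \<in> A"
    proof (cases "m \<ge> 0")
      case True
      then have "0 \<le> m * (x - a)" "m * (x - a) \<le> m * (b - a)"
        using x by (auto intro: mult_left_mono)
      then show ?thesis unfolding A_def using affine[OF x] gb by auto
    next
      case False
      then have "m * (x - a) \<le> 0" "m * (b - a) \<le> m * (x - a)"
        using x by (auto intro: mult_left_mono_neg mult_nonpos_nonneg)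
      then show ?thesis unfolding A_def using affine[OF x] gb by auto
    qed
    then show "x \<in> g -` A \<inter> {0..1}" using x ab by auto
  qed
  ultimately have "emeasure lborel {a..b} \<le> emeasure lborel A"
    unfolding meas by (rule emeasure_mono[rotated])
  then have "b - a \<le> max (g a) (g b) - min (g a) (g b)"
    using ab by (simp add: A_def)
  also have "\<dots> = \<bar>m * (b - a)\<bar>"
    unfolding gb by linarith
  also have "\<dots> = \<bar>m\<bar> * (b - a)"
    using ab by (simp add: abs_mult)
  finally show ?thesis using ab by simp
qed

text \<open>Expansion rules out negative exponents in the slope \<open>s * 2 powi k\<close>, which
  makes it a nonzero integer. Only the open interval has to avoid \<open>nondiff_points g\<close>,
  so the lemma applies to grid cells whose endpoints are corners of the graph.\<close>

lemma thompson_monoid_slope: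
  assumes g: "g \<in> thompson_monoid"
    and ab: "0 \<le> a" "a < b" "b \<le> 1" "{a<..<b} \<inter> nondiff_points g = {}"
  obtains m where "m \<in> \<int>" "m \<noteq> 0" "\<And>x. x \<in> {a<..<b} \<Longrightarrow> (g has_real_derivative m) (at x)"
    "g b - g a = m * (b - a)"
proof -
  have cont: "continuous_on {0..1} g" and maps: "g ` {0..1} \<subseteq> {0..1}"
    and pres: "lebesgue_preserving g"
    and slopes: "\<And>a b. 0 \<le> a \<and> a < b \<and> b \<le> 1 \<and> (\<forall>x\<in>{a<..<b}. g differentiable (at x)) \<Longrightarrow>
      \<exists>s\<in>{1, -1}. \<exists>k::int. \<forall>x\<in>{a<..<b}. (g has_real_derivative s * 2 powi k) (at x)"
    using g unfolding thompson_monoid_def by simp_all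
  \<comment> \<open>Differentiability within \<open>{0..1}\<close> is two-sided at interior
    points.\<close>
  have "g differentiable (at x)" if "x \<in> {a<..<b}" for x
  proof -
    have "x \<in> interior {0..1}" using that ab by auto
    moreover have "g differentiable (at x within {0..1})"
      using that ab by (auto simp: nondiff_points_def disjoint_iff)
    ultimately show ?thesis using at_within_interior by fastforce
  qed
  then obtain s :: real and k :: int where s: "s \<in> {1, -1}"
    and deriv: "\<And>x. x \<in> {a<..<b} \<Longrightarrow> (g has_real_derivative s * 2 powi k) (at x)"
    using slopes[of a b] ab by blast
  define m where "m = s * 2 powi k"
  \<comment> \<open>By the mean value theorem on \<open>{a..x}\<close>, the constant derivative
    determines the increment; continuity lets \<open>x\<close> reach the endpoint
    \<open>b\<close>.\<close>
  have affine: "g x = g a + m * (x - a)" if x: "x \<in> {a..b}" for x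
  proof (cases "x = a")
    case False
    then have "a < x" using x by simp
    moreover have "continuous_on {a..x} g"
      using continuous_on_subset[OF cont] x ab by auto
    moreover have "(g has_real_derivative m) (at z)" if "a < z" "z < x" for z
      using deriv that x by (auto simp: m_def)
    ultimately obtain l z where "a < z" "z < x" "(g has_real_derivative l) (at z)"
      "g x - g a = (x - a) * l"
      using MVT[of a x g] real_differentiable_def by blast
    moreover from this have "l = m"
      using DERIV_unique[of g l z m] deriv[of z] x by (simp add: m_def)
    ultimately show ?thesis by (simp add: algebra_simps)
  qed simp
  have "\<bar>m\<bar> \<ge> 1"
    by (rule lebesgue_preserving_expanding[OF cont maps pres ab(1-3) affine])
  moreover have "\<bar>m\<bar> = 2 powi k" using s by (auto simp: m_def abs_mult)
  ultimately have "k \<ge> 0"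
    using power_int_strict_increasing[of k 0 "2::real"] by (cases "k < 0") auto
  then have "m = s * 2 ^ nat k" by (simp add: m_def power_int_def)
  then have "m \<in> \<int>" using s by (auto intro: Ints_power)
  moreover have "m \<noteq> 0" using \<open>\<bar>m\<bar> \<ge> 1\<close> by auto
  ultimately show ?thesis using that deriv affine[of b] ab by (simp add: m_def)
qed

theorem corollary12:
  fixes g :: "real \<Rightarrow> real"
  assumes "g \<in> thompson_monoid"
  shows "markov_map g"
proof -
  have cont: "continuous_on {0..1} g" and onto: "g ` {0..1} = {0..1}"
    and pa: "piecewise_affine g" and fin: "finite (nondiff_points g)"
    and dy: "\<forall>x\<in>nondiff_points g. dyadic x"
    using assms unfolding thompson_monoid_def by simp_all
  obtain N where N: "\<And>x. x \<in> nondiff_points g \<Longrightarrow> x * 2 ^ N \<in> \<int>"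
    using dyadic_common_denominator[OF fin dy] by blast
  define D where "D = {x \<in> {0..1::real}. x * 2 ^ N \<in> \<int>}"
  \<comment> \<open>A non-differentiability point inside a cell would, once scaled by
    \<open>2 ^ N\<close>, be an integer strictly between \<open>j\<close> and
    \<open>j + 1\<close>.\<close>
  have cell: "{real j / 2 ^ N<..<real (Suc j) / 2 ^ N} \<inter> nondiff_points g = {}" for j
  proof -
    have False if x: "real j / 2 ^ N < x" "x < real (Suc j) / 2 ^ N" "x * 2 ^ N \<in> \<int>" for x
    proof -
      obtain i where i: "x * 2 ^ N = of_int i" using x(3) by (auto elim: Ints_cases)
      have "real j < x * 2 ^ N" "x * 2 ^ N < real (Suc j)" using x(1,2) by (simp_all add: field_simps)
      then have "int j < i" "i < int j + 1" unfolding i by linarith+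
      then show False by simp
    qed
    then show ?thesis using N by (auto simp: disjoint_iff)
  qed
  \<comment> \<open>Used twice: to place a zero of \<open>g\<close> on the grid, and to show that
    every breakpoint lies there.\<close>
  have off_grid: "\<exists>a b m. 0 \<le> a \<and> b \<le> 1 \<and> x \<in> {a<..<b} \<and> m \<noteq> 0 \<and>
      (\<forall>y\<in>{a<..<b}. (g has_real_derivative m) (at y))" if x: "x \<in> {0..1}" "x \<notin> D" for x
  proof -
    define j where "j = nat \<lfloor>x * 2 ^ N\<rfloor>"
    have rj: "real j = of_int \<lfloor>x * 2 ^ N\<rfloor>" using x by (simp add: j_def)
    have "x * 2 ^ N \<notin> \<int>" using x by (simp add: D_def)
    \<comment> \<open>The floor gives only a weak lower bound; it is strict because \<open>x\<close>
      is off the grid.\<close>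
    then have "real j \<noteq> x * 2 ^ N" unfolding rj by (metis Ints_of_int)
    then have j: "real j < x * 2 ^ N" "x * 2 ^ N < real (Suc j)" using rj by linarith+
    have "x * 2 ^ N \<le> 2 ^ N" using x by simp
    then have "real j < 2 ^ N" using j(1) by linarith
    then have "Suc j \<le> 2 ^ N" by simp
    then have "real (Suc j) \<le> real (2 ^ N)" by (rule of_nat_mono)
    then have le1: "real (Suc j) / 2 ^ N \<le> 1" by simp
    obtain m where "m \<noteq> 0" "\<And>y. y \<in> {real j / 2 ^ N<..<real (Suc j) / 2 ^ N} \<Longrightarrow>
        (g has_real_derivative m) (at y)"
      using thompson_monoid_slope[OF assms _ _ le1 cell] by (auto simp: divide_strict_right_mono)
    moreover have "x \<in> {real j / 2 ^ N<..<real (Suc j) / 2 ^ N}"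
      using j by (auto simp: field_simps)
    moreover have "0 \<le> real j / 2 ^ N" by simp
    ultimately show ?thesis using le1 by blast
  qed
  obtain z where z: "z \<in> {0..1}" "g z = 0"
    using onto by (metis atLeastAtMost_iff imageE order_refl zero_le_one)
  \<comment> \<open>The value \<open>0\<close> is the minimum of \<open>g\<close> on
    \<open>{0..1}\<close>, so off the grid the derivative at \<open>z\<close> would vanish,
    contradicting the nonzero slope.\<close>
  have "z \<in> D"
  proof (rule ccontr)
    assume "z \<notin> D"
    then obtain a b m where abm: "0 \<le> a" "b \<le> 1" "z \<in> {a<..<b}" "m \<noteq> 0"
      "(g has_real_derivative m) (at z)"
      using off_grid[OF z(1)] by blast
    have "g z \<le> g y" if "\<bar>z - y\<bar> < min (z - a) (b - z)" for y
    proof -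
      have "y \<in> {0..1}" using that abm by auto
      then show ?thesis using onto z by auto
    qed
    then have "m = 0"
      using DERIV_local_min[OF abm(5), of "min (z - a) (b - z)"] abm(3) by auto
    then show False using abm by simp
  qed
  \<comment> \<open>Crossing one cell of width \<open>1 / 2 ^ N\<close> changes \<open>g\<close> by
    an integer slope times that width; the induction sums these changes from
    \<open>0\<close>.\<close>
  have increment: "(g (real j / 2 ^ N) - g 0) * 2 ^ N \<in> \<int>" if "j \<le> 2 ^ N" for j
    using that
  proof (induction j)
    case (Suc j)
    have "real (Suc j) \<le> real (2 ^ N)" using Suc.prems by (rule of_nat_mono)
    then have le1: "real (Suc j) / 2 ^ N \<le> 1" by simp
    obtain m where m: "m \<in> \<int>" "g (real (Suc j) / 2 ^ N) - g (real j / 2 ^ N) =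
        m * (real (Suc j) / 2 ^ N - real j / 2 ^ N)"
      using thompson_monoid_slope[OF assms _ _ le1 cell] by (auto simp: divide_strict_right_mono)
    then have "g (real (Suc j) / 2 ^ N) = g (real j / 2 ^ N) + m / 2 ^ N"
      by (simp add: field_simps)
    then have "(g (real (Suc j) / 2 ^ N) - g 0) * 2 ^ N = (g (real j / 2 ^ N) - g 0) * 2 ^ N + m"
      by (simp add: field_simps)
    then show ?case using Suc m(1) by simp
  qed simp
  have grid: "\<exists>j\<le>2 ^ N. x = real j / 2 ^ N" if x: "x \<in> D" for x
  proof -
    have "0 \<le> x * 2 ^ N" "x * 2 ^ N \<le> 2 ^ N" using x by (auto simp: D_def)
    moreover obtain i where i: "x * 2 ^ N = of_int i"
      using x by (auto simp: D_def elim: Ints_cases)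
    ultimately have "0 \<le> i" "real_of_int i \<le> of_int (2 ^ N)" by auto
    then have "0 \<le> i" "i \<le> 2 ^ N" by (simp_all only: of_int_le_iff)
    then have "nat i \<le> 2 ^ N" "x = real (nat i) / 2 ^ N"
      using i by (auto simp: nat_le_iff field_simps)
    then show ?thesis by blast
  qed
  have "D \<subseteq> (\<lambda>j. real j / 2 ^ N) ` {..2 ^ N}"
    using grid by blast
  then have "finite D"
    using finite_subset by blast
  moreover have "g ` D \<subseteq> D"
  proof
    fix y assume "y \<in> g ` D"
    then obtain x where x: "x \<in> D" "y = g x" by blast
    \<comment> \<open>Increments control \<open>g\<close> only up to the constant
      \<open>g 0\<close>. Subtracting the one at \<open>z\<close> cancels it, and
      \<open>g z = 0\<close> leaves \<open>g x\<close> alone.\<close>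
    have "(g x - g 0) * 2 ^ N \<in> \<int>" "(g z - g 0) * 2 ^ N \<in> \<int>"
      using increment grid[OF x(1)] grid[OF \<open>z \<in> D\<close>] by blast+
    then have "(g x - g 0) * 2 ^ N - (g z - g 0) * 2 ^ N \<in> \<int>" by (rule Ints_diff)
    then have "g x * 2 ^ N \<in> \<int>" using z by (simp add: algebra_simps)
    then show "y \<in> D" using x onto by (auto simp: D_def)
  qed
  moreover have "x \<in> D" if x: "x \<in> breakpoints g" for x
  proof (rule ccontr)
    assume "x \<notin> D"
    moreover have "0 \<in> D" "1 \<in> D" by (auto simp: D_def)
    ultimately have x01: "x \<in> {0..1}" "x \<noteq> 0" "x \<noteq> 1"
      using x by (auto simp: breakpoints_def)
    obtain a b m where abm: "x \<in> {a<..<b}"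
      "\<And>y. y \<in> {a<..<b} \<Longrightarrow> (g has_real_derivative m) (at y)"
      using off_grid[OF x01(1) \<open>x \<notin> D\<close>] by blast
    have "g differentiable (at x)" using abm real_differentiable_def by blast
    \<comment> \<open>Near an off-grid point \<open>deriv g\<close> is locally constant, hence
      continuous, so such a point is not a breakpoint.\<close>
    moreover have "eventually (\<lambda>y. deriv g y = m) (nhds x)"
      using eventually_nhds_in_open[OF open_greaterThanLessThan abm(1)]
      by (rule eventually_mono) (rule DERIV_imp_deriv, rule abm(2))
    then have "isCont (deriv g) x"
      using isCont_cong[of "deriv g" "\<lambda>_. m" x] by simp
    then have "continuous (at x within {y \<in> {0<..<1}. g differentiable (at y)}) (deriv g)"
      by (rule continuous_at_imp_continuous_at_within)
    ultimately show False using x x01 by (auto simp: breakpoints_def)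
  qed
  ultimately have "preperiodic g x" if "x \<in> breakpoints g" for x
    using that by (intro preperiodic_finite_invariant[of D])
  then show ?thesis
    using cont onto pa by (auto simp: markov_map_def interval_map_def)
qed

end
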